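(* Let $n\ge 1$. For any $\gamma\in\mathbb{C}$, the spatial Fourier transform of the fundamental solution to the heat equation $$\frac{\partial\rho}{\partial s}=-\mathcal{L}_\gamma\rho\quad (s>0,\ (x,y,t)\in\mathbb{H}^n),\qquad \rho(s=0,x,y,t)=\delta_0(x,y,t)$$ is given, for $s>0$ and $(\alpha,\beta,\tau)\in\mathbb{R}^n\times\mathbb{R}^n\times\mathbb{R}$, by $$\hat\rho^\gamma(s,\alpha,\beta,\tau)=\frac{e^{-\gamma s\tau/4}}{(\cosh(s\tau/2))^{n/2}}\;e^{-A(|\alpha|^2+|\beta|^2)/2+iB\,\alpha\cdot\beta},$$ where $$A=\frac{\sinh(s\tau/2)}{\tau\cosh(s\tau/2)},\qquad B=\frac{2\sinh^2(s\tau/4)}{\tau\cosh(s\tau/2)}.$$ That is, $\hat\rho^\gamma$ solves the Fourier-transformed initial value problem $$\frac{\partial\hat\rho^\gamma}{\partial s}=\frac14\left(\sum_{j=1}^n\Big(-\alpha_j^2-2i\alpha_j\tau\frac{\partial}{\partial\beta_j}+\tau^2\frac{\partial^2}{\partial\beta_j^2}-\beta_j^2\Big)-\gamma\tau\right)\hat\rho^\gamma\quad (s>0),\qquad \hat\rho^\gamma(s=0,\alpha,\beta,\tau)=1.$$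
   Context: The Heisenberg group is $\mathbb{H}^n=\mathbb{R}^n\times\mathbb{R}^n\times\mathbb{R}$ with group law $(x,y,t)*(x',y',t')=(x+x',\,y+y',\,t+t'+x\cdot y')$, where $\cdot$ is the standard dot product on $\mathbb{R}^n$. The vector fields used are $$X_j=\frac{\partial}{\partial x_j}+y_j\frac{\partial}{\partial t},\qquad Y_j=\frac{\partial}{\partial y_j}\quad(1\le j\le n),\qquad T=\frac{\partial}{\partial t}.$$ For $\gamma\in\mathbb{C}$, $$\mathcal{L}_\gamma=-\frac14\left(\sum_{j=1}^n(X_j^2+Y_j^2)+i\gamma T\right).$$ Here $s$ is the time variable and $(x,y,t)$ are the spatial variables; $\delta_0$ is the delta function at the origin of $\mathbb{H}^n$. The spatial Fourier transform (in $(x,y,t)$, not in $s$) is $$\hat f(\alpha,\beta,\tau)=\int_{\mathbb{H}^n}f(x,y,t)\,e^{-i(\alpha\cdot x+\beta\cdot y+\tau t)}\,dx\,dy\,dt,\qquad \alpha,\beta\in\mathbb{R}^n,\ \tau\in\mathbb{R}.$$ Under this transform $X_j^2$ becomes $-\alpha_j^2-2i\alpha_j\tau\,\partial_{\beta_j}+\tau^2\partial_{\beta_j}^2$, $Y_j^2$ becomes multiplication by $-\beta_j^2$, $T$ becomes multiplication by $i\tau$, and $\delta_0$ becomes the constant $1$; the heat problem is understood on the Fourier transform side in this way. At $\tau=0$, $A$ and $B$ are interpreted by continuity, i.e. $A=s/2$ and $B=0$. The value at $s=0$ means the limit as $s\to0^+$. *)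

theory Defs
  imports "HOL-Analysis.Analysis" "HOL-Real_Asymp.Real_Asymp"
begin

text \<open>
  The Heisenberg group of dimension \<open>2n + 1\<close> is \<open>real^'n \<times> real^'n \<times> real\<close> with \<open>n = CARD('n)\<close>, and
  \<open>\<alpha>\<close>, \<open>\<beta>\<close>, \<open>\<tau>\<close> are dual to \<open>x\<close>, \<open>y\<close>, \<open>t\<close>.  The spatial Fourier transform
  \<open>\<integral> f(x,y,t) exp (-\<i> (\<alpha> \<bullet> x + \<beta> \<bullet> y + \<tau> t)) d(x,y,t)\<close> turns \<open>\<partial>/\<partial>x\<^sub>j\<close>, \<open>\<partial>/\<partial>t\<close> into multiplication by
  \<open>\<i> \<alpha>\<^sub>j\<close>, \<open>\<i> \<tau>\<close>, and multiplication by \<open>y\<^sub>j\<close> into \<open>\<i> \<partial>/\<partial>\<beta>\<^sub>j\<close>.  For general complex \<open>\<gamma>\<close> the transform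
  may grow exponentially in \<open>\<tau>\<close>, so the heat problem is posed on the Fourier side.
  The operators below act on functions of \<open>\<beta>\<close>, with \<open>\<alpha>\<close> and \<open>\<tau>\<close> as parameters.
\<close>

definition partial_differentiable :: "'n::finite \<Rightarrow> (real^'n \<Rightarrow> complex) \<Rightarrow> real^'n \<Rightarrow> bool" where
  "partial_differentiable j f \<beta> \<longleftrightarrow> (\<lambda>h::real. f (\<beta> + h *\<^sub>R axis j 1)) differentiable (at 0)"

definition partial_deriv :: "'n::finite \<Rightarrow> (real^'n \<Rightarrow> complex) \<Rightarrow> real^'n \<Rightarrow> complex" where
  "partial_deriv j f \<beta> = vector_derivative (\<lambda>h::real. f (\<beta> + h *\<^sub>R axis j 1)) (at 0)"

text \<open>
  Transform of \<open>X\<^sub>j\<^sup>2\<close> for \<open>X\<^sub>j = \<partial>/\<partial>x\<^sub>j + y\<^sub>j \<partial>/\<partial>t\<close>; it is the square of \<open>\<i> \<alpha>\<^sub>j - \<tau> \<partial>/\<partial>\<beta>\<^sub>j\<close>.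
\<close>
definition X_sq_hat ::
  "real^'n::finite \<Rightarrow> real \<Rightarrow> 'n \<Rightarrow> (real^'n \<Rightarrow> complex) \<Rightarrow> real^'n \<Rightarrow> complex" where
  "X_sq_hat \<alpha> \<tau> j f \<beta> =
     - complex_of_real ((\<alpha> $ j)\<^sup>2) * f \<beta>
     - 2 * \<i> * complex_of_real (\<alpha> $ j * \<tau>) * partial_deriv j f \<beta>
     + complex_of_real (\<tau>\<^sup>2) * partial_deriv j (partial_deriv j f) \<beta>"

text \<open>Transform of \<open>Y\<^sub>j\<^sup>2\<close> for \<open>Y\<^sub>j = \<partial>/\<partial>y\<^sub>j\<close>.\<close>
definition Y_sq_hat :: "'n::finite \<Rightarrow> (real^'n \<Rightarrow> complex) \<Rightarrow> real^'n \<Rightarrow> complex" where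
  "Y_sq_hat j f \<beta> = - complex_of_real ((\<beta> $ j)\<^sup>2) * f \<beta>"

text \<open>Transform of \<open>T = \<partial>/\<partial>t\<close>.\<close>
definition T_hat :: "real \<Rightarrow> (real^'n::finite \<Rightarrow> complex) \<Rightarrow> real^'n \<Rightarrow> complex" where
  "T_hat \<tau> f \<beta> = \<i> * complex_of_real \<tau> * f \<beta>"

text \<open>Transform of \<open>\<L>\<^sub>\<gamma> = - (\<Sum>\<^sub>j (X\<^sub>j\<^sup>2 + Y\<^sub>j\<^sup>2) + \<i> \<gamma> T) / 4\<close>.\<close>
definition L_hat ::
  "complex \<Rightarrow> real^'n::finite \<Rightarrow> real \<Rightarrow> (real^'n \<Rightarrow> complex) \<Rightarrow> real^'n \<Rightarrow> complex" where
  "L_hat \<gamma> \<alpha> \<tau> f \<beta> =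
     - (1 / 4) * ((\<Sum>j\<in>UNIV. X_sq_hat \<alpha> \<tau> j f \<beta> + Y_sq_hat j f \<beta>) + \<i> * \<gamma> * T_hat \<tau> f \<beta>)"

lemma neg_L_hat_eq:
  "- L_hat \<gamma> \<alpha> \<tau> f \<beta> =
     1 / 4 * ((\<Sum>j\<in>UNIV.
         - complex_of_real ((\<alpha> $ j)\<^sup>2) * f \<beta>
         - 2 * \<i> * complex_of_real (\<alpha> $ j * \<tau>) * partial_deriv j f \<beta>
         + complex_of_real (\<tau>\<^sup>2) * partial_deriv j (partial_deriv j f) \<beta>
         - complex_of_real ((\<beta> $ j)\<^sup>2) * f \<beta>)
       - \<gamma> * complex_of_real \<tau> * f \<beta>)"
  by (simp add: L_hat_def X_sq_hat_def Y_sq_hat_def T_hat_def algebra_simps)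

text \<open>
  The second component is the transform of the initial condition \<open>\<rho>(0, x, y, t) = \<delta>\<^sub>0(x, y, t)\<close>: the
  transform of \<open>\<delta>\<^sub>0\<close> is the constant \<open>1\<close>, and the value at \<open>s = 0\<close> is the limit from the right.
\<close>
definition solves_heat_problem_hat ::
  "complex \<Rightarrow> (real \<Rightarrow> real^'n::finite \<Rightarrow> real^'n \<Rightarrow> real \<Rightarrow> complex) \<Rightarrow> bool" where
  "solves_heat_problem_hat \<gamma> u \<longleftrightarrow>
     (\<forall>s>0. \<forall>\<alpha> \<beta> \<tau>.
        (\<forall>j. partial_differentiable j (\<lambda>b. u s \<alpha> b \<tau>) \<beta> \<and>
             partial_differentiable j (partial_deriv j (\<lambda>b. u s \<alpha> b \<tau>)) \<beta>) \<and>
        ((\<lambda>r. u r \<alpha> \<beta> \<tau>) has_vector_derivative - L_hat \<gamma> \<alpha> \<tau> (\<lambda>b. u s \<alpha> b \<tau>) \<beta>) (at s)) \<and>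
     (\<forall>\<alpha> \<beta> \<tau>. ((\<lambda>s. u s \<alpha> \<beta> \<tau>) \<longlongrightarrow> 1) (at_right 0))"

definition heat_A :: "real \<Rightarrow> real \<Rightarrow> real" where
  "heat_A s \<tau> = (if \<tau> = 0 then s / 2 else sinh (s * \<tau> / 2) / (\<tau> * cosh (s * \<tau> / 2)))"

definition heat_B :: "real \<Rightarrow> real \<Rightarrow> real" where
  "heat_B s \<tau> = (if \<tau> = 0 then 0 else 2 * (sinh (s * \<tau> / 4))\<^sup>2 / (\<tau> * cosh (s * \<tau> / 2)))"

text \<open>The values at \<open>\<tau> = 0\<close> are the continuous extensions.\<close>

lemma isCont_heat_A: "isCont (heat_A s) 0"
proof -
  have "((\<lambda>x. sinh (s * x / 2) / (x * cosh (s * x / 2))) \<longlongrightarrow> s / 2) (at 0)"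
  proof (rule filterlim_split_at)
    show "((\<lambda>x. sinh (s * x / 2) / (x * cosh (s * x / 2))) \<longlongrightarrow> s / 2) (at_left 0)"
      by (cases s "0::real" rule: linorder_cases; real_asymp)
    show "((\<lambda>x. sinh (s * x / 2) / (x * cosh (s * x / 2))) \<longlongrightarrow> s / 2) (at_right 0)"
      by (cases s "0::real" rule: linorder_cases; real_asymp)
  qed
  then show ?thesis
    by (auto simp: isCont_def heat_A_def[abs_def] eventually_at_filter elim!: Lim_transform_eventually)
qed

lemma isCont_heat_B: "isCont (heat_B s) 0"
proof -
  have "((\<lambda>x. 2 * (sinh (s * x / 4))\<^sup>2 / (x * cosh (s * x / 2))) \<longlongrightarrow> 0) (at 0)"
  proof (rule filterlim_split_at)
    show "((\<lambda>x. 2 * (sinh (s * x / 4))\<^sup>2 / (x * cosh (s * x / 2))) \<longlongrightarrow> 0) (at_left 0)"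
      by (cases s "0::real" rule: linorder_cases; real_asymp)
    show "((\<lambda>x. 2 * (sinh (s * x / 4))\<^sup>2 / (x * cosh (s * x / 2))) \<longlongrightarrow> 0) (at_right 0)"
      by (cases s "0::real" rule: linorder_cases; real_asymp)
  qed
  then show ?thesis
    by (auto simp: isCont_def heat_B_def[abs_def] eventually_at_filter elim!: Lim_transform_eventually)
qed

end

theory Submission imports Defs begin

text \<open>
  On the Fourier side \<open>- \<L>\<^sub>\<gamma>\<close> is quadratic in \<open>\<beta>\<close> and \<open>\<partial>/\<partial>\<beta>\<close>, so its evolution preserves the
  form \<open>exp (quadratic polynomial in \<beta>)\<close>.  For the ansatz
  \<open>exp (c - a (|\<alpha>|\<^sup>2 + |\<beta>|\<^sup>2) / 2 + \<i> b \<alpha> \<bullet> \<beta>)\<close>, whose coefficients \<open>c\<close>, \<open>a\<close>, \<open>b\<close> depend on \<open>s\<close>,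
  the operator multiplies by
  \<open>(- (1 - \<tau> b)\<^sup>2 |\<alpha>|\<^sup>2 - (1 - (\<tau> a)\<^sup>2) |\<beta>|\<^sup>2 + 2 \<i> \<tau> a (1 - \<tau> b) \<alpha> \<bullet> \<beta> - n \<tau>\<^sup>2 a - \<gamma> \<tau>) / 4\<close>
  (lemma \<open>neg_L_hat_heat_ansatz\<close>).  Comparing coefficients with the \<open>s\<close>-derivative gives the
  Riccati-type system
  \<open>a' = (1 - (\<tau> a)\<^sup>2) / 2\<close>, \<open>b' = \<tau> a (1 - \<tau> b) / 2\<close>, \<open>c' = - (\<gamma> \<tau> + n \<tau>\<^sup>2 a) / 4\<close>,
  together with the compatibility condition \<open>(1 - \<tau> b)\<^sup>2 = 1 - (\<tau> a)\<^sup>2\<close>, which is forced because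
  \<open>|\<alpha>|\<^sup>2\<close> and \<open>|\<beta>|\<^sup>2\<close> carry the same coefficient \<open>a\<close>.

  The functions \<open>A\<close> and \<open>B\<close> solve this system with zero initial values, since
  \<open>\<tau> A = tanh (s \<tau> / 2)\<close> and \<open>1 - \<tau> B = 1 / cosh (s \<tau> / 2)\<close>; compatibility is the identity
  \<open>1 - tanh\<^sup>2 = 1 / cosh\<^sup>2\<close>.  Integrating \<open>c'\<close> gives
  \<open>c = - \<gamma> s \<tau> / 4 - (n / 2) ln (cosh (s \<tau> / 2))\<close>, which is the prefactor of the stated
  formula.  All of this makes sense for every real \<open>s\<close>, so the initial condition is continuity at
  \<open>s = 0\<close>, where the whole exponent vanishes.
\<close>

section \<open>The coefficient functions and their differential equations\<close>

lemma tau_heat_A: "\<tau> * heat_A s \<tau> = tanh (s * \<tau> / 2)"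
  by (simp add: heat_A_def tanh_def)

lemma one_minus_tau_heat_B: "1 - \<tau> * heat_B s \<tau> = 1 / cosh (s * \<tau> / 2)"
proof (cases "\<tau> = 0")
  case False
  have "2 * (sinh (s * \<tau> / 4))\<^sup>2 = cosh (s * \<tau> / 2) - 1"
    using cosh_double[of "s * \<tau> / 4"] cosh_square_eq[of "s * \<tau> / 4"]
    by (simp add: mult.commute)
  then have "\<tau> * heat_B s \<tau> = (cosh (s * \<tau> / 2) - 1) / cosh (s * \<tau> / 2)"
    using False by (simp add: heat_B_def)
  then show ?thesis
    by (simp add: diff_divide_distrib)
qed (simp add: heat_B_def)

lemma heat_A_heat_B_compatible: "(1 - \<tau> * heat_B s \<tau>)\<^sup>2 = 1 - (\<tau> * heat_A s \<tau>)\<^sup>2"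
proof -
  have "(cosh (s * \<tau> / 2))\<^sup>2 \<noteq> 0"
    by simp
  then show ?thesis
    unfolding tau_heat_A one_minus_tau_heat_B tanh_def power_divide
    by (simp add: divide_simps del: power_eq_0_iff) (simp add: cosh_square_eq)
qed

lemma heat_A_0 [simp]: "heat_A 0 \<tau> = 0" and heat_B_0 [simp]: "heat_B 0 \<tau> = 0"
  by (simp_all add: heat_A_def heat_B_def)

lemma heat_A_has_real_derivative:
  "((\<lambda>s. heat_A s \<tau>) has_real_derivative (1 - (\<tau> * heat_A s \<tau>)\<^sup>2) / 2) (at s)"
proof (cases "\<tau> = 0")
  case True
  then show ?thesis
    by (auto simp: heat_A_def intro!: derivative_eq_intros)
next
  case False
  then have "heat_A r \<tau> = tanh (r * \<tau> / 2) / \<tau>" for r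
    using tau_heat_A[of \<tau> r] by (simp add: field_simps)
  moreover have "((\<lambda>r. tanh (r * \<tau> / 2) / \<tau>) has_real_derivative
      (1 - (tanh (s * \<tau> / 2))\<^sup>2) / 2) (at s)"
    using False by (auto intro!: derivative_eq_intros)
  ultimately show ?thesis
    using False by simp
qed

lemma heat_B_has_real_derivative:
  "((\<lambda>s. heat_B s \<tau>) has_real_derivative \<tau> * heat_A s \<tau> * (1 - \<tau> * heat_B s \<tau>) / 2) (at s)"
proof (cases "\<tau> = 0")
  case True
  then show ?thesis
    by (simp add: heat_B_def)
next
  case False
  then have "(\<lambda>r. heat_B r \<tau>) = (\<lambda>r. (1 - 1 / cosh (r * \<tau> / 2)) / \<tau>)"
    by (simp add: one_minus_tau_heat_B[symmetric])
  moreover have "((\<lambda>r. (1 - 1 / cosh (r * \<tau> / 2)) / \<tau>) has_real_derivative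
      tanh (s * \<tau> / 2) * (1 / cosh (s * \<tau> / 2)) / 2) (at s)"
    using False
    by (auto intro!: derivative_eq_intros simp: tanh_def field_simps power2_eq_square)
  ultimately show ?thesis
    unfolding tau_heat_A one_minus_tau_heat_B by simp
qed

lemma ln_cosh_has_real_derivative:
  "((\<lambda>s. ln (cosh (s * \<tau> / 2))) has_real_derivative \<tau>\<^sup>2 * heat_A s \<tau> / 2) (at s)"
proof -
  have "\<tau>\<^sup>2 * heat_A s \<tau> = \<tau> * tanh (s * \<tau> / 2)"
    by (simp add: tau_heat_A[symmetric] power2_eq_square)
  then show ?thesis
    by (auto intro!: derivative_eq_intros simp: tanh_def)
qed

section \<open>The Gaussian ansatz\<close>

definition heat_ansatz ::
  "complex \<Rightarrow> real \<Rightarrow> real \<Rightarrow> real^'n::finite \<Rightarrow> real^'n \<Rightarrow> complex" where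
  "heat_ansatz c a b \<alpha> \<beta> =
     exp (c + complex_of_real (- a * ((norm \<alpha>)\<^sup>2 + (norm \<beta>)\<^sup>2) / 2)
            + \<i> * complex_of_real (b * (\<alpha> \<bullet> \<beta>)))"

text \<open>
  The exponent is kept in the shape of that of \<open>heat_ansatz\<close>, so that this one chain rule serves
  for derivatives in \<open>s\<close> as well as along a coordinate axis.
\<close>
lemma exp_has_vector_derivative_re_im:
  fixes p q :: "real \<Rightarrow> real"
  assumes "(c has_vector_derivative c') (at x)"
    and "(p has_real_derivative p') (at x)" and "(q has_real_derivative q') (at x)"
  shows "((\<lambda>x. exp (c x + complex_of_real (p x) + \<i> * complex_of_real (q x)))
     has_vector_derivative
       (c' + complex_of_real p' + \<i> * complex_of_real q')
       * exp (c x + complex_of_real (p x) + \<i> * complex_of_real (q x))) (at x)"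
proof -
  have "((\<lambda>x. c x + complex_of_real (p x) + \<i> * complex_of_real (q x))
      has_vector_derivative (c' + complex_of_real p' + \<i> * complex_of_real q')) (at x)"
    using assms
    by (intro has_vector_derivative_add has_vector_derivative_mult_right
          has_vector_derivative_of_real) auto
  from field_vector_diff_chain_at[OF this DERIV_exp] show ?thesis
    by (simp add: o_def)
qed

lemma inner_axis_shift: "\<alpha> \<bullet> (\<beta> + h *\<^sub>R axis j 1) = \<alpha> \<bullet> \<beta> + h * \<alpha> $ j"
  for \<alpha> \<beta> :: "real^'n::finite"
  by (simp add: inner_add_right inner_axis)

lemma norm_axis_shift: "(norm (\<beta> + h *\<^sub>R axis j 1))\<^sup>2 = (norm \<beta>)\<^sup>2 + 2 * h * \<beta> $ j + h\<^sup>2"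
  for \<beta> :: "real^'n::finite"
  unfolding power2_norm_eq_inner
  by (simp add: inner_add_right inner_add_left inner_axis inner_axis' power2_eq_square
      algebra_simps)

lemma heat_ansatz_axis_derivative:
  fixes \<alpha> \<beta> :: "real^'n::finite"
  shows "((\<lambda>h. heat_ansatz c a b \<alpha> (\<beta> + h *\<^sub>R axis j 1)) has_vector_derivative
     (complex_of_real (- a * \<beta> $ j) + \<i> * complex_of_real (b * \<alpha> $ j)) * heat_ansatz c a b \<alpha> \<beta>)
     (at 0)"
proof -
  have "((\<lambda>h. exp (c + complex_of_real (- a * ((norm \<alpha>)\<^sup>2 + ((norm \<beta>)\<^sup>2 + 2 * h * \<beta> $ j + h\<^sup>2)) / 2)
            + \<i> * complex_of_real (b * (\<alpha> \<bullet> \<beta> + h * \<alpha> $ j)))) has_vector_derivative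
     (0 + complex_of_real (- a * \<beta> $ j) + \<i> * complex_of_real (b * \<alpha> $ j)) *
     exp (c + complex_of_real (- a * ((norm \<alpha>)\<^sup>2 + ((norm \<beta>)\<^sup>2 + 2 * 0 * \<beta> $ j + 0\<^sup>2)) / 2)
            + \<i> * complex_of_real (b * (\<alpha> \<bullet> \<beta> + 0 * \<alpha> $ j)))) (at 0)"
    by (rule exp_has_vector_derivative_re_im) (auto intro!: derivative_eq_intros)
  then show ?thesis
    by (simp add: heat_ansatz_def inner_axis_shift norm_axis_shift)
qed

lemma partial_deriv_heat_ansatz:
  "partial_deriv j (heat_ansatz c a b \<alpha>) =
     (\<lambda>\<beta>. (complex_of_real (- a * \<beta> $ j) + \<i> * complex_of_real (b * \<alpha> $ j)) * heat_ansatz c a b \<alpha> \<beta>)"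
  unfolding partial_deriv_def
  by (intro ext vector_derivative_at heat_ansatz_axis_derivative)

lemma partial_deriv_heat_ansatz_axis_derivative:
  fixes \<alpha> \<beta> :: "real^'n::finite"
  shows "((\<lambda>h. partial_deriv j (heat_ansatz c a b \<alpha>) (\<beta> + h *\<^sub>R axis j 1)) has_vector_derivative
     ((complex_of_real (- a * \<beta> $ j) + \<i> * complex_of_real (b * \<alpha> $ j))\<^sup>2 - complex_of_real a)
       * heat_ansatz c a b \<alpha> \<beta>) (at 0)"
proof -
  have "((\<lambda>h. complex_of_real (- a * (\<beta> $ j + h)) + \<i> * complex_of_real (b * \<alpha> $ j))
      has_vector_derivative complex_of_real (- a) + 0) (at 0)"
    by (intro has_vector_derivative_add has_vector_derivative_of_real has_vector_derivative_const)
      (auto intro!: derivative_eq_intros)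
  from has_vector_derivative_mult[OF this heat_ansatz_axis_derivative[of c a b \<alpha> \<beta> j]]
  show ?thesis
    by (simp add: partial_deriv_heat_ansatz algebra_simps power2_eq_square)
qed

lemma partial_differentiable_heat_ansatz:
  "partial_differentiable j (heat_ansatz c a b \<alpha>) \<beta>"
  "partial_differentiable j (partial_deriv j (heat_ansatz c a b \<alpha>)) \<beta>"
  unfolding partial_differentiable_def
  using heat_ansatz_axis_derivative partial_deriv_heat_ansatz_axis_derivative
  by (blast intro: differentiableI_vector)+

lemma partial_deriv_twice_heat_ansatz:
  "partial_deriv j (partial_deriv j (heat_ansatz c a b \<alpha>)) \<beta> =
     ((complex_of_real (- a * \<beta> $ j) + \<i> * complex_of_real (b * \<alpha> $ j))\<^sup>2 - complex_of_real a)
       * heat_ansatz c a b \<alpha> \<beta>"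
  by (subst partial_deriv_def)
    (rule vector_derivative_at[OF partial_deriv_heat_ansatz_axis_derivative])

text \<open>
  In each coordinate the terms \<open>\<alpha>\<^sub>j\<^sup>2\<close> collect into \<open>- (1 - \<tau> b)\<^sup>2\<close>, because the transform of \<open>X\<^sub>j\<close>
  sends the ansatz to \<open>\<i> \<alpha>\<^sub>j (1 - \<tau> b) + \<tau> a \<beta>\<^sub>j\<close> times itself.
\<close>
lemma neg_L_hat_heat_ansatz:
  fixes \<alpha> \<beta> :: "real^'n::finite"
  shows "- L_hat \<gamma> \<alpha> \<tau> (heat_ansatz c a b \<alpha>) \<beta> =
     (- (\<gamma> * complex_of_real \<tau> + complex_of_real (real CARD('n) * \<tau>\<^sup>2 * a)) / 4
      + complex_of_real (- ((1 - \<tau> * b)\<^sup>2 * (norm \<alpha>)\<^sup>2 + (1 - (\<tau> * a)\<^sup>2) * (norm \<beta>)\<^sup>2) / 4)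
      + \<i> * complex_of_real (\<tau> * a * (1 - \<tau> * b) / 2 * (\<alpha> \<bullet> \<beta>))) * heat_ansatz c a b \<alpha> \<beta>"
proof -
  let ?u = "heat_ansatz c a b \<alpha> \<beta>"
  let ?m = "\<lambda>j. - complex_of_real ((1 - \<tau> * b)\<^sup>2) * complex_of_real (\<alpha> $ j * \<alpha> $ j)
      - complex_of_real (1 - (\<tau> * a)\<^sup>2) * complex_of_real (\<beta> $ j * \<beta> $ j)
      + 2 * \<i> * complex_of_real (\<tau> * a * (1 - \<tau> * b)) * complex_of_real (\<alpha> $ j * \<beta> $ j)
      - complex_of_real (\<tau>\<^sup>2 * a)"
  have *: "X_sq_hat \<alpha> \<tau> j (heat_ansatz c a b \<alpha>) \<beta> + Y_sq_hat j (heat_ansatz c a b \<alpha>) \<beta> = ?m j * ?u"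
    for j
  proof -
    define d where "d = complex_of_real (- a * \<beta> $ j) + \<i> * complex_of_real (b * \<alpha> $ j)"
    have "- complex_of_real ((\<alpha> $ j)\<^sup>2) - 2 * \<i> * complex_of_real (\<alpha> $ j * \<tau>) * d
        + complex_of_real (\<tau>\<^sup>2) * (d\<^sup>2 - complex_of_real a) - complex_of_real ((\<beta> $ j)\<^sup>2) = ?m j"
      unfolding d_def by (simp add: complex_eq_iff power2_eq_square algebra_simps)
    moreover have "X_sq_hat \<alpha> \<tau> j (heat_ansatz c a b \<alpha>) \<beta> + Y_sq_hat j (heat_ansatz c a b \<alpha>) \<beta> =
        (- complex_of_real ((\<alpha> $ j)\<^sup>2) - 2 * \<i> * complex_of_real (\<alpha> $ j * \<tau>) * d
        + complex_of_real (\<tau>\<^sup>2) * (d\<^sup>2 - complex_of_real a) - complex_of_real ((\<beta> $ j)\<^sup>2)) * ?u"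
      unfolding X_sq_hat_def Y_sq_hat_def partial_deriv_twice_heat_ansatz
      unfolding partial_deriv_heat_ansatz d_def
      by (simp add: algebra_simps)
    ultimately show ?thesis
      by simp
  qed
  have sums: "(\<Sum>j\<in>UNIV. complex_of_real (x $ j * y $ j)) = complex_of_real (x \<bullet> y)"
    for x y :: "real^'n"
    by (simp add: inner_vec_def)
  have total: "(\<Sum>j\<in>UNIV. ?m j) =
      - complex_of_real ((1 - \<tau> * b)\<^sup>2) * complex_of_real (\<alpha> \<bullet> \<alpha>)
      - complex_of_real (1 - (\<tau> * a)\<^sup>2) * complex_of_real (\<beta> \<bullet> \<beta>)
      + 2 * \<i> * complex_of_real (\<tau> * a * (1 - \<tau> * b)) * complex_of_real (\<alpha> \<bullet> \<beta>)
      - of_nat CARD('n) * complex_of_real (\<tau>\<^sup>2 * a)"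
    by (simp only: sum.distrib sum_subtractf sum_distrib_left[symmetric] sums sum_constant)
  show ?thesis
    unfolding L_hat_def * sum_distrib_right[symmetric] total T_hat_def power2_norm_eq_inner
    by (simp add: algebra_simps add_divide_distrib diff_divide_distrib)
qed

section \<open>The solution as a curve of ansatz functions\<close>

definition heat_log_prefactor :: "complex \<Rightarrow> real \<Rightarrow> real \<Rightarrow> real \<Rightarrow> complex" where
  "heat_log_prefactor \<gamma> n s \<tau> =
     - \<gamma> * complex_of_real (s * \<tau>) / 4 - complex_of_real (n / 2 * ln (cosh (s * \<tau> / 2)))"

lemma heat_log_prefactor_has_vector_derivative:
  "((\<lambda>s. heat_log_prefactor \<gamma> n s \<tau>) has_vector_derivative
     - (\<gamma> * complex_of_real \<tau> + complex_of_real (n * \<tau>\<^sup>2 * heat_A s \<tau>)) / 4) (at s)"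
proof -
  have "((\<lambda>s. s * \<tau>) has_real_derivative \<tau>) (at s)"
    by (auto intro!: derivative_eq_intros)
  moreover have "((\<lambda>s. n / 2 * ln (cosh (s * \<tau> / 2))) has_real_derivative
      n / 2 * (\<tau>\<^sup>2 * heat_A s \<tau> / 2)) (at s)"
    by (rule DERIV_cmult[OF ln_cosh_has_real_derivative])
  ultimately have "((\<lambda>s. - \<gamma> / 4 * complex_of_real (s * \<tau>)
        - complex_of_real (n / 2 * ln (cosh (s * \<tau> / 2)))) has_vector_derivative
      - \<gamma> / 4 * complex_of_real \<tau> - complex_of_real (n / 2 * (\<tau>\<^sup>2 * heat_A s \<tau> / 2))) (at s)"
    by (intro has_vector_derivative_diff has_vector_derivative_mult_right
          has_vector_derivative_of_real)
  then show ?thesis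
    by (simp add: heat_log_prefactor_def add_divide_distrib diff_divide_distrib mult.assoc)
qed

lemma exp_heat_log_prefactor:
  "exp (heat_log_prefactor \<gamma> n s \<tau>) =
     exp (- \<gamma> * complex_of_real (s * \<tau>) / 4) / complex_of_real (cosh (s * \<tau> / 2) powr (n / 2))"
  by (simp add: heat_log_prefactor_def exp_diff powr_def flip: exp_of_real)

abbreviation heat_solution ::
  "complex \<Rightarrow> real \<Rightarrow> real^'n::finite \<Rightarrow> real^'n \<Rightarrow> real \<Rightarrow> complex" where
  "heat_solution \<gamma> s \<alpha> \<beta> \<tau> \<equiv>
     heat_ansatz (heat_log_prefactor \<gamma> (real CARD('n)) s \<tau>) (heat_A s \<tau>) (heat_B s \<tau>) \<alpha> \<beta>"

text \<open>
  The \<open>s\<close>-derivative of the exponent agrees with the multiplier of \<open>neg_L_hat_heat_ansatz\<close> term by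
  term; only the coefficient of \<open>|\<alpha>|\<^sup>2\<close> requires the compatibility of \<open>A\<close> and \<open>B\<close>.
\<close>
lemma heat_solution_has_vector_derivative:
  fixes \<alpha> \<beta> :: "real^'n::finite"
  shows "((\<lambda>s. heat_solution \<gamma> s \<alpha> \<beta> \<tau>) has_vector_derivative
     - L_hat \<gamma> \<alpha> \<tau> (\<lambda>b. heat_solution \<gamma> s \<alpha> b \<tau>) \<beta>) (at s)"
proof -
  let ?A = "heat_A s \<tau>" and ?B = "heat_B s \<tau>" and ?N = "(norm \<alpha>)\<^sup>2 + (norm \<beta>)\<^sup>2"
  have "((\<lambda>s. - heat_A s \<tau> * ?N / 2) has_real_derivative
      - ((1 - \<tau> * ?B)\<^sup>2 * (norm \<alpha>)\<^sup>2 + (1 - (\<tau> * ?A)\<^sup>2) * (norm \<beta>)\<^sup>2) / 4) (at s)"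
    unfolding heat_A_heat_B_compatible
    by (auto intro!: derivative_eq_intros heat_A_has_real_derivative simp: field_simps)
  from exp_has_vector_derivative_re_im[OF heat_log_prefactor_has_vector_derivative this
      DERIV_cmult_right[OF heat_B_has_real_derivative]]
  show ?thesis
    unfolding neg_L_hat_heat_ansatz unfolding heat_ansatz_def .
qed

lemma heat_solution_initial: "heat_solution \<gamma> 0 \<alpha> \<beta> \<tau> = 1"
  by (simp add: heat_ansatz_def heat_log_prefactor_def)

theorem theorem1p2:
  fixes \<gamma> :: complex
    and \<rho>_hat :: "real \<Rightarrow> real^'n::finite \<Rightarrow> real^'n \<Rightarrow> real \<Rightarrow> complex"
  assumes "\<And>s \<alpha> \<beta> \<tau>. s > 0 \<Longrightarrow>
    \<rho>_hat s \<alpha> \<beta> \<tau> =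
      exp (- \<gamma> * complex_of_real (s * \<tau>) / 4)
        / complex_of_real (cosh (s * \<tau> / 2) powr (real CARD('n) / 2))
      * exp (- complex_of_real (heat_A s \<tau> * ((norm \<alpha>)\<^sup>2 + (norm \<beta>)\<^sup>2) / 2)
             + \<i> * complex_of_real (heat_B s \<tau> * (\<alpha> \<bullet> \<beta>)))"
  shows "solves_heat_problem_hat \<gamma> \<rho>_hat"
proof -
  have eq: "\<rho>_hat s \<alpha> \<beta> \<tau> = heat_solution \<gamma> s \<alpha> \<beta> \<tau>" if "s > 0" for s \<alpha> \<beta> \<tau>
    unfolding assms[OF that] heat_ansatz_def exp_heat_log_prefactor[symmetric]
    by (simp add: exp_add[symmetric] algebra_simps add_divide_distrib diff_divide_distrib)
  have deriv: "((\<lambda>r. \<rho>_hat r \<alpha> \<beta> \<tau>) has_vector_derivative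
      - L_hat \<gamma> \<alpha> \<tau> (\<lambda>b. \<rho>_hat s \<alpha> b \<tau>) \<beta>) (at s)" if "s > 0" for s \<alpha> \<beta> \<tau>
    unfolding eq[OF that]
    by (rule has_vector_derivative_transform_within_open[where S = "{0<..}",
          OF heat_solution_has_vector_derivative]) (use that in \<open>auto simp: eq\<close>)
  have initial: "((\<lambda>s. \<rho>_hat s \<alpha> \<beta> \<tau>) \<longlongrightarrow> 1) (at_right 0)" for \<alpha> \<beta> \<tau>
  proof -
    have "isCont (\<lambda>s. heat_solution \<gamma> s \<alpha> \<beta> \<tau>) 0"
      by (rule has_vector_derivative_continuous[OF heat_solution_has_vector_derivative])
    then have "((\<lambda>s. heat_solution \<gamma> s \<alpha> \<beta> \<tau>) \<longlongrightarrow> 1) (at_right 0)"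
      unfolding isCont_def heat_solution_initial by (rule tendsto_within_subset) simp
    moreover have "\<forall>\<^sub>F s in at_right 0. heat_solution \<gamma> s \<alpha> \<beta> \<tau> = \<rho>_hat s \<alpha> \<beta> \<tau>"
      using eventually_at_right_less[of "0::real"] by eventually_elim (simp add: eq)
    ultimately show ?thesis
      by (rule Lim_transform_eventually)
  qed
  show ?thesis
    unfolding solves_heat_problem_hat_def
    using deriv initial by (auto simp: eq partial_differentiable_heat_ansatz)
qed

end
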